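(* Let $\mu_{2n}\setminus\mu_n=H\sqcup F\sqcup C$ be a partition of the set of $n$th roots of $-1$ such that $|F|=|C|$ and each of $H,F,C$ is closed under complex conjugation. For each $\zeta\in H$ with $\zeta\neq-1$ pick a unit vector $(v_\zeta,u_\zeta)\in\mathbb{C}^2$ such that $v_{\bar\zeta}=\overline{u_\zeta}$ and $u_{\bar\zeta}=\overline{v_\zeta}$; if $\zeta=-1\in H$ pick $u_\zeta=1/\sqrt2$ and $v_\zeta=\pm1/\sqrt2$. Then the $2n\times 2n$ matrix $$X=\sum_{\zeta\in H}\begin{bmatrix}u_\zeta\overline{u_\zeta} & u_\zeta\overline{v_\zeta}\\ v_\zeta\overline{u_\zeta} & v_\zeta\overline{v_\zeta}\end{bmatrix}\otimes N_\zeta+\sum_{\zeta\in F}I_2\otimes N_\zeta$$ is a self-adjoint idempotent of rank $n$ in $\mathcal{PD}_n$. Furthermore, every self-adjoint idempotent of rank $n$ in $\mathcal{PD}_n$ is of this form.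
   Context: $\mu_m$ is the set of $m$th roots of unity. Indices of $n\times n$ matrices run over $0,\dots,n-1$. For an $n$th root $\zeta$ of $-1$, $N_\zeta=\tfrac1n(\chi(i,j)\zeta^{j-i})_{i,j}$ where $\chi(i,j)=1$ if $i\le j$ and $-1$ if $i>j$. An $n\times n$ matrix is negacirculant if there is $w=(w_0,\dots,w_{n-1})$ with $(i,j)$ entry $w_{j-i}$ for $j\ge i$ and $-w_{n+j-i}$ for $j<i$. $\mathcal{PD}_n$ is the set of all complex $2n\times 2n$ block matrices $[A,B;B^\top,A^\top]$ with $A,B$ complex negacirculant $n\times n$ matrices. $A\otimes B$ is the Kronecker product $(A_{i,j}B)_{i,j}$.
   Formalization: The printed condition is false (n=2, H={i,-i}, u_i=v_{-i}=1/√2, v_i=i/√2, u_{-i}=-i/√2); it is replaced by v_{ζ̄}=u_ζ, u_{ζ̄}=v_ζ without conjugation, and the exponent j-i in N_ζ is read modulo n in {0,…,n-1}, so that N_ζ is negacirculant and self-adjoint. *)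

theory Defs
  imports
    "HOL-Analysis.Analysis"
    "Jordan_Normal_Form.Schur_Decomposition"
    "Jordan_Normal_Form.DL_Rank"
begin

definition mu :: "nat \<Rightarrow> complex set" where
  "mu m = {z. z ^ m = 1}"

definition chi :: "nat \<Rightarrow> nat \<Rightarrow> complex" where
  "chi i j = (if i \<le> j then 1 else -1)"

(* Matrix indices are residues modulo n, so the exponent j - i of zeta is its representative
   in {0..<n}. As zeta^n = -1, the sign chi then makes every entry equal to zeta^(j-i)/n with the
   ordinary integer exponent, i.e. N n zeta is the negacirculant matrix of w_k = zeta^k/n.
   Combining chi with the integer exponent would give a matrix that is in general
   neither negacirculant nor self-adjoint. *)
definition N :: "nat \<Rightarrow> complex \<Rightarrow> complex mat" where
  "N n \<zeta> = mat n n (\<lambda>(i, j). chi i j * \<zeta> ^ nat ((int j - int i) mod int n) / of_nat n)"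

definition negacirculant :: "nat \<Rightarrow> complex mat \<Rightarrow> bool" where
  "negacirculant n A \<longleftrightarrow>
     (\<exists>w :: nat \<Rightarrow> complex. A = mat n n (\<lambda>(i, j). if i \<le> j then w (j - i) else - w (n + j - i)))"

definition PD :: "nat \<Rightarrow> complex mat set" where
  "PD n = {four_block_mat A B (transpose_mat B) (transpose_mat A) | A B.
             negacirculant n A \<and> negacirculant n B}"

definition kronecker :: "complex mat \<Rightarrow> complex mat \<Rightarrow> complex mat" (infixl "\<otimes>\<^sub>K" 70) where
  "A \<otimes>\<^sub>K B = mat (dim_row A * dim_row B) (dim_col A * dim_col B)
     (\<lambda>(i, j). A $$ (i div dim_row B, j div dim_col B) * B $$ (i mod dim_row B, j mod dim_col B))"

definition self_adjoint_idempotent_of_rank :: "nat \<Rightarrow> nat \<Rightarrow> complex mat \<Rightarrow> bool" where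
  "self_adjoint_idempotent_of_rank m r X \<longleftrightarrow>
     X \<in> carrier_mat m m \<and> mat_adjoint X = X \<and> X * X = X \<and> vec_space.rank m X = r"

(* The parts of the partition may be empty. *)
definition root_partition :: "nat \<Rightarrow> complex set \<Rightarrow> complex set \<Rightarrow> complex set \<Rightarrow> bool" where
  "root_partition n H F C \<longleftrightarrow>
     H \<union> F \<union> C = mu (2 * n) - mu n \<and>
     H \<inter> F = {} \<and> H \<inter> C = {} \<and> F \<inter> C = {} \<and>
     card F = card C \<and>
     (\<forall>\<zeta>\<in>H. cnj \<zeta> \<in> H) \<and> (\<forall>\<zeta>\<in>F. cnj \<zeta> \<in> F) \<and> (\<forall>\<zeta>\<in>C. cnj \<zeta> \<in> C)"

(* The vectors at zeta and cnj zeta are exchanged by the coordinate swap, without conjugating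
   their entries. Since transpose_mat (N n zeta) = N n (cnj zeta), a matrix
   (sum over zeta of M_zeta (x) N n zeta) lies in PD n iff M_(cnj zeta) = J M_zeta J for the swap
   J of the two coordinates, with no conjugation of M_zeta. The variant
   v (cnj zeta) = cnj (u zeta), u (cnj zeta) = cnj (v zeta) would give
   M_(cnj zeta) = J (conjugate of M_zeta) J and leave PD n unless u zeta * cnj (v zeta) is real:
   for n = 2, H = {i, -i}, u i = v (-i) = 1/sqrt 2, v i = i/sqrt 2, u (-i) = -i/sqrt 2,
   the off-diagonal blocks of X are the scalar matrices -i/2 and i/2, which are not
   transposes of each other. *)
definition unit_vector_choice ::
    "complex set \<Rightarrow> (complex \<Rightarrow> complex) \<Rightarrow> (complex \<Rightarrow> complex) \<Rightarrow> bool" where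
  "unit_vector_choice H u v \<longleftrightarrow>
     (\<forall>\<zeta>\<in>H. \<zeta> \<noteq> -1 \<longrightarrow>
        (cmod (v \<zeta>))\<^sup>2 + (cmod (u \<zeta>))\<^sup>2 = 1 \<and> v (cnj \<zeta>) = u \<zeta> \<and> u (cnj \<zeta>) = v \<zeta>) \<and>
     (-1 \<in> H \<longrightarrow>
        u (-1) = of_real (1 / sqrt 2) \<and>
        (v (-1) = of_real (1 / sqrt 2) \<or> v (-1) = - of_real (1 / sqrt 2)))"

definition X_mat :: "nat \<Rightarrow> complex set \<Rightarrow> complex set \<Rightarrow>
    (complex \<Rightarrow> complex) \<Rightarrow> (complex \<Rightarrow> complex) \<Rightarrow> complex mat" where
  "X_mat n H F u v =
     finsum (module_mat TYPE(complex) (2 * n) (2 * n))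
       (\<lambda>\<zeta>. mat_of_rows_list 2
              [[u \<zeta> * cnj (u \<zeta>), u \<zeta> * cnj (v \<zeta>)],
               [v \<zeta> * cnj (u \<zeta>), v \<zeta> * cnj (v \<zeta>)]] \<otimes>\<^sub>K N n \<zeta>) H
   + finsum (module_mat TYPE(complex) (2 * n) (2 * n)) (\<lambda>\<zeta>. 1\<^sub>m 2 \<otimes>\<^sub>K N n \<zeta>) F"

end

theory Submission
  imports Defs
begin

text \<open>The matrices \<open>N n \<zeta>\<close>, for \<open>\<zeta>\<close> an \<open>n\<close>th root of \<open>-1\<close>, are mutually orthogonal rank-one
projections with sum \<open>1\<close>, and they form a basis of the negacirculant matrices. Since transposition
exchanges \<open>N n \<zeta>\<close> and \<open>N n (cnj \<zeta>)\<close>, the members of \<open>PD n\<close> are the sums of \<open>M \<zeta> \<otimes> N n \<zeta>\<close> over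
families of \<open>2 \<times> 2\<close> matrices such that \<open>M (cnj \<zeta>)\<close> is \<open>M \<zeta>\<close> conjugated by the coordinate swap. Such a
sum is a self-adjoint idempotent iff every \<open>M \<zeta>\<close> is one, and its rank is the sum of the
ranks of the \<open>M \<zeta>\<close>. The sets \<open>H\<close>, \<open>F\<close>, \<open>C\<close> collect the \<open>\<zeta>\<close> for which \<open>M \<zeta>\<close> has rank \<open>1\<close>, \<open>2\<close>, \<open>0\<close>, so
rank \<open>n = card H + card F + card C\<close> means \<open>card F = card C\<close>.\<close>

section \<open>The \<open>n\<close>th roots of \<open>-1\<close> and their orthogonality
  relations\<close>

definition negaroots :: "nat \<Rightarrow> complex set" where
  "negaroots n = {z. z ^ n = -1}"

lemma mu_diff_eq_negaroots: "mu (2 * n) - mu n = negaroots n"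
proof -
  have "z ^ (2 * n) = 1 \<and> z ^ n \<noteq> 1 \<longleftrightarrow> z ^ n = -1" for z :: complex
    by (auto simp: power_even_eq power2_eq_1_iff)
  then show ?thesis by (auto simp: mu_def negaroots_def)
qed

lemma finite_negaroots: "n \<ge> 1 \<Longrightarrow> finite (negaroots n)"
  unfolding negaroots_def by (rule finite_nth_roots) simp

lemma card_negaroots: "n \<ge> 1 \<Longrightarrow> card (negaroots n) = n"
  unfolding negaroots_def by (rule card_nth_roots) auto

lemma cnj_negaroots [simp]: "cnj \<zeta> \<in> negaroots n \<longleftrightarrow> \<zeta> \<in> negaroots n"
proof -
  have "cnj \<zeta> ^ n = -1 \<longleftrightarrow> \<zeta> ^ n = -1"
    using complex_cnj_cancel_iff[of "\<zeta> ^ n" "-1"] by simp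
  then show ?thesis by (simp add: negaroots_def)
qed

lemma sum_negaroots_cnj: "(\<Sum>\<zeta>\<in>negaroots n. f (cnj \<zeta>)) = (\<Sum>\<zeta>\<in>negaroots n. f \<zeta>)"
  by (rule sum.reindex_bij_witness[of _ cnj cnj]) auto

lemma negaroots_mult_cnj:
  assumes "n \<ge> 1" "\<zeta> \<in> negaroots n"
  shows "\<zeta> * cnj \<zeta> = 1"
proof -
  have "cmod \<zeta> ^ n = 1"
    using assms(2) by (simp add: negaroots_def flip: norm_power)
  then have "cmod \<zeta> = 1"
    using assms(1) power_eq_imp_eq_base[of "cmod \<zeta>" n 1] by simp
  then show ?thesis by (simp flip: complex_norm_square)
qed

text \<open>Since \<open>cnj \<zeta>\<close> is the inverse of \<open>\<zeta>\<close>, a power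
  depending on \<open>b - a\<close> splits into a factor for the column \<open>b\<close> and one for
  the row \<open>a\<close>. This product form is what the later sums over entries use.\<close>

lemma negaroots_power_shift:
  assumes "n \<ge> 1" "\<zeta> \<in> negaroots n" "a \<le> b"
  shows "\<zeta> ^ b * cnj \<zeta> ^ a = \<zeta> ^ (b - a)"
proof -
  have "\<zeta> ^ b * cnj \<zeta> ^ a = \<zeta> ^ (b - a) * (\<zeta> * cnj \<zeta>) ^ a"
    using assms(3) by (simp add: power_mult_distrib flip: power_add)
  then show ?thesis using negaroots_mult_cnj[OF assms(1,2)] by simp
qed

text \<open>Below the diagonal the exponent is raised by \<open>n\<close>, and
  \<open>\<zeta> ^ n = -1\<close> supplies exactly the sign of a negacirculant matrix.\<close>

lemma negaroots_power_shift':
  assumes "n \<ge> 1" "\<zeta> \<in> negaroots n" "b < a" "a < n"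
  shows "\<zeta> ^ b * cnj \<zeta> ^ a = - (\<zeta> ^ (n + b - a))"
proof -
  have "\<zeta> ^ (n + b) * cnj \<zeta> ^ a = \<zeta> ^ (n + b - a)"
    using assms by (intro negaroots_power_shift) auto
  moreover have "\<zeta> ^ n = -1" using assms(2) by (simp add: negaroots_def)
  ultimately have "- (\<zeta> ^ b * cnj \<zeta> ^ a) = \<zeta> ^ (n + b - a)" by (simp add: power_add)
  then show ?thesis by (metis minus_minus)
qed

text \<open>For distinct roots the ratio \<open>\<zeta> * cnj \<xi>\<close> is an \<open>n\<close>th
  root of unity other than \<open>1\<close>, so its geometric sum over a full period
  vanishes.\<close>

lemma sum_power_negaroots:
  assumes n: "n \<ge> 1" and R: "\<zeta> \<in> negaroots n" "\<xi> \<in> negaroots n"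
  shows "(\<Sum>k<n. \<zeta> ^ k * cnj \<xi> ^ k) = (if \<zeta> = \<xi> then of_nat n else 0)"
proof (cases "\<zeta> = \<xi>")
  case True
  then show ?thesis
    using negaroots_mult_cnj[OF n R(2)] by (simp flip: power_mult_distrib)
next
  case False
  have "\<zeta> * cnj \<xi> \<noteq> 1"
  proof
    assume "\<zeta> * cnj \<xi> = 1"
    then have "\<zeta> * cnj \<xi> = \<xi> * cnj \<xi>" using negaroots_mult_cnj[OF n R(2)] by simp
    moreover have "cnj \<xi> \<noteq> 0" using negaroots_mult_cnj[OF n R(2)] by auto
    ultimately show False using False by simp
  qed
  moreover have "(\<zeta> * cnj \<xi>) ^ n = 1"
    using R cnj_negaroots[of \<xi> n] by (simp add: power_mult_distrib negaroots_def)
  ultimately have "(\<Sum>k<n. (\<zeta> * cnj \<xi>) ^ k) = 0"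
    by (simp add: geometric_sum)
  then show ?thesis using False by (simp add: power_mult_distrib)
qed

text \<open>Multiplication by the primitive \<open>n\<close>th root of unity
  \<open>\<epsilon>\<close> permutes the roots of \<open>-1\<close> and scales the sum by
  \<open>\<epsilon> ^ k\<close>, which differs from \<open>1\<close>.\<close>

lemma sum_negaroots_power:
  assumes n: "n \<ge> 1" and k: "0 < k" "k < n"
  shows "(\<Sum>\<zeta>\<in>negaroots n. \<zeta> ^ k) = 0"
proof -
  define \<epsilon> where "\<epsilon> = cis (2 * pi / n)"
  have e: "\<epsilon> ^ n = 1" using n unfolding \<epsilon>_def Complex.DeMoivre by simp
  have e0: "\<epsilon> \<noteq> 0" by (simp add: \<epsilon>_def)
  have ek: "\<epsilon> ^ k \<noteq> 1"
  proof
    assume "\<epsilon> ^ k = 1"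
    then have "cos (2 * pi * k / n) = 1"
      unfolding \<epsilon>_def Complex.DeMoivre by (simp add: complex_eq_iff mult_ac)
    then obtain m :: int where "2 * pi * k / n = real_of_int m * 2 * pi"
      unfolding cos_one_2pi_int by blast
    then have "2 * pi * real k = 2 * pi * (real_of_int m * n)" using n by (simp add: divide_simps mult_ac)
    then have "real k = real_of_int m * n" by simp
    then have "int k = m * int n"
      by (metis of_int_eq_iff of_int_mult of_int_of_nat_eq)
    then have "n dvd k" by (metis dvd_triv_right int_dvd_int_iff)
    then show False using k by (simp add: nat_dvd_not_less)
  qed
  have "(\<Sum>\<zeta>\<in>negaroots n. \<zeta> ^ k) = (\<Sum>\<zeta>\<in>negaroots n. (\<epsilon> * \<zeta>) ^ k)"
    by (rule sum.reindex_bij_witness[of _ "\<lambda>z. \<epsilon> * z" "\<lambda>z. z / \<epsilon>"])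
      (use e e0 in \<open>simp_all add: negaroots_def power_mult_distrib power_divide\<close>)
  also have "\<dots> = \<epsilon> ^ k * (\<Sum>\<zeta>\<in>negaroots n. \<zeta> ^ k)"
    by (simp add: power_mult_distrib sum_distrib_left)
  finally show ?thesis using ek by auto
qed

text \<open>Orthogonality in the dual direction: \<open>sum_power_negaroots\<close> sums over
  positions, this one over roots.\<close>

lemma sum_negaroots_power_cnj:
  assumes n: "n \<ge> 1" and ab: "a < n" "b < n"
  shows "(\<Sum>\<zeta>\<in>negaroots n. \<zeta> ^ b * cnj \<zeta> ^ a) = (if a = b then of_nat n else 0)"
proof -
  consider "a = b" | "a < b" | "b < a" by linarith
  then show ?thesis
  proof cases
    case 1
    then show ?thesis
      using negaroots_power_shift[OF n, of _ a a] card_negaroots[OF n] by simp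
  next
    case 2
    then show ?thesis
      using sum_negaroots_power[OF n, of "b - a"] ab negaroots_power_shift[OF n, of _ a b] by simp
  next
    \<comment> \<open>The exponent \<open>n + b - a\<close> again lies strictly between
      \<open>0\<close> and \<open>n\<close>, so the power sum vanishes here too.\<close>
    case 3
    then show ?thesis
      using sum_negaroots_power[OF n, of "n + b - a"] ab negaroots_power_shift'[OF n, of _ b a]
      by (simp add: sum_negf)
  qed
qed

section \<open>Negacirculant matrices and the discrete Fourier transform\<close>

text \<open>This is the sum of \<open>c \<zeta>\<close> times \<open>N n \<zeta>\<close>, with
  entries in product form so that no case distinction appears. The values \<open>c \<zeta>\<close>
  are its eigenvalues.\<close>

definition negacirc :: "nat \<Rightarrow> (complex \<Rightarrow> complex) \<Rightarrow> complex mat" where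
  "negacirc n c = mat n n (\<lambda>(a, b). \<Sum>\<zeta>\<in>negaroots n. c \<zeta> * \<zeta> ^ b * cnj \<zeta> ^ a / of_nat n)"

text \<open>A discrete Fourier transform over the roots of \<open>-1\<close> turns the generating
  vector \<open>w\<close> into the coefficients \<open>c\<close>;
  \<open>sum_negaroots_power_cnj\<close> gives the inversion.\<close>

lemma negacirculant_iff:
  assumes n: "n \<ge> 1"
  shows "negacirculant n A \<longleftrightarrow> (\<exists>c. A = negacirc n c)"
proof -
  \<comment> \<open>\<open>W c\<close> is the first row of \<open>negacirc n c\<close>, hence its
    generating vector.\<close>
  define W where "W c k = (\<Sum>\<zeta>\<in>negaroots n. c \<zeta> * \<zeta> ^ k / of_nat n)" for c :: "complex \<Rightarrow> complex" and k
  have S: "negacirc n c = mat n n (\<lambda>(i, j). if i \<le> j then W c (j - i) else - W c (n + j - i))" for c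
    by (rule eq_matI)
      (auto simp: negacirc_def W_def negaroots_power_shift[OF n] negaroots_power_shift'[OF n] mult.assoc
        simp flip: sum_negf)
  \<comment> \<open>Fourier inversion: after exchanging the sums only the term \<open>l = k\<close>
    is left.\<close>
  have W: "W (\<lambda>\<zeta>. \<Sum>l<n. w l * cnj \<zeta> ^ l) k = w k" if "k < n" for w k
  proof -
    have "W (\<lambda>\<zeta>. \<Sum>l<n. w l * cnj \<zeta> ^ l) k =
        (\<Sum>l<n. \<Sum>\<zeta>\<in>negaroots n. w l / of_nat n * (\<zeta> ^ k * cnj \<zeta> ^ l))"
      unfolding W_def
      by (subst sum.swap) (simp add: sum_distrib_left sum_divide_distrib mult_ac)
    also have "\<dots> = (\<Sum>l<n. w l / of_nat n * (if l = k then of_nat n else 0))"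
      using that
      by (intro sum.cong refl) (simp only: sum_negaroots_power_cnj[OF n] lessThan_iff flip: sum_distrib_left)
    also have "\<dots> = w k" using that n by (simp add: if_distrib[of "\<lambda>x. _ * x"] cong: if_cong)
    finally show ?thesis .
  qed
  show ?thesis
  proof
    assume "negacirculant n A"
    then obtain w where A: "A = mat n n (\<lambda>(i, j). if i \<le> j then w (j - i) else - w (n + j - i))"
      unfolding negacirculant_def by blast
    have "A = negacirc n (\<lambda>\<zeta>. \<Sum>l<n. w l * cnj \<zeta> ^ l)"
      unfolding S A by (rule eq_matI) (auto simp: W)
    then show "\<exists>c. A = negacirc n c" by blast
  next
    assume "\<exists>c. A = negacirc n c"
    then show "negacirculant n A" unfolding negacirculant_def S by blast
  qed
qed

section \<open>Sums of Kronecker products with \<open>N n \<zeta>\<close>, handled root by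
  root\<close>

text \<open>The sum of \<open>M \<zeta> \<otimes> N n \<zeta>\<close>, where \<open>M \<zeta> s t\<close> only matters for \<open>s, t < 2\<close>.\<close>

definition spectral :: "nat \<Rightarrow> (complex \<Rightarrow> nat \<Rightarrow> nat \<Rightarrow> complex) \<Rightarrow> complex mat" where
  "spectral n M = mat (2 * n) (2 * n) (\<lambda>(i, j).
     \<Sum>\<zeta>\<in>negaroots n. M \<zeta> (i div n) (j div n) * \<zeta> ^ (j mod n) * cnj \<zeta> ^ (i mod n) / of_nat n)"

lemma spectral_carrier [simp]: "spectral n M \<in> carrier_mat (2 * n) (2 * n)"
  by (simp add: spectral_def)

lemma dim_spectral [simp]: "dim_row (spectral n M) = 2 * n" "dim_col (spectral n M) = 2 * n"
  by (simp_all add: spectral_def)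

lemma div_less_2: "i < 2 * n \<Longrightarrow> i div n < (2 :: nat)"
  by (simp add: less_mult_imp_div_less)

lemma spectral_cong:
  assumes "\<And>\<zeta> s t. \<zeta> \<in> negaroots n \<Longrightarrow> s < 2 \<Longrightarrow> t < 2 \<Longrightarrow> M \<zeta> s t = M' \<zeta> s t"
  shows "spectral n M = spectral n M'"
  unfolding spectral_def by (rule eq_matI) (simp_all add: assms div_less_2)

text \<open>Row \<open>s * n\<close> is the first row of block row \<open>s\<close>, where
  \<open>cnj \<zeta> ^ 0\<close> drops out; pairing it with the powers of \<open>cnj \<xi>\<close>
  isolates a single root.\<close>

lemma spectral_coefficient:
  assumes n: "n \<ge> 1" and R: "\<xi> \<in> negaroots n" and st: "s < 2" "t < 2"
  shows "(\<Sum>b<n. spectral n M $$ (s * n, t * n + b) * cnj \<xi> ^ b) = M \<xi> s t"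
proof -
  have lt: "s * n < 2 * n" "b < n \<Longrightarrow> t * n + b < 2 * n" for b
    using st n by (auto simp: less_2_cases_iff)
  have "(\<Sum>b<n. spectral n M $$ (s * n, t * n + b) * cnj \<xi> ^ b) =
      (\<Sum>b<n. \<Sum>\<zeta>\<in>negaroots n. M \<zeta> s t / of_nat n * (\<zeta> ^ b * cnj \<xi> ^ b))"
    using n lt by (intro sum.cong) (auto simp: spectral_def sum_distrib_left mult_ac)
  also have "\<dots> = (\<Sum>\<zeta>\<in>negaroots n. M \<zeta> s t / of_nat n * (if \<zeta> = \<xi> then of_nat n else 0))"
    by (subst sum.swap)
      (intro sum.cong refl, simp only: sum_power_negaroots[OF n _ R] flip: sum_distrib_left)
  also have "\<dots> = M \<xi> s t"
    using R n finite_negaroots[OF n] by (simp add: if_distrib[of "\<lambda>x. _ * x"] cong: if_cong)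
  finally show ?thesis .
qed

text \<open>Uniqueness of the coefficients allows matrix identities to be checked on one
  \<open>2 \<times> 2\<close> matrix per root.\<close>

lemma spectral_eq_iff:
  assumes n: "n \<ge> 1"
  shows "spectral n M = spectral n M' \<longleftrightarrow> (\<forall>\<zeta>\<in>negaroots n. \<forall>s<2. \<forall>t<2. M \<zeta> s t = M' \<zeta> s t)"
proof
  assume eq: "spectral n M = spectral n M'"
  show "\<forall>\<zeta>\<in>negaroots n. \<forall>s<2. \<forall>t<2. M \<zeta> s t = M' \<zeta> s t"
  proof (intro ballI allI impI)
    fix \<zeta> s t assume "\<zeta> \<in> negaroots n" and "s < (2 :: nat)" "t < (2 :: nat)"
    then show "M \<zeta> s t = M' \<zeta> s t"
      using spectral_coefficient[OF n, of \<zeta> s t M] spectral_coefficient[OF n, of \<zeta> s t M'] eq by simp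
  qed
qed (blast intro: spectral_cong)

text \<open>Orthogonality over the roots says that the matrices \<open>N n \<zeta>\<close> sum to
  the identity.\<close>

lemma spectral_one:
  assumes n: "n \<ge> 1"
  shows "spectral n (\<lambda>\<zeta> s t. if s = t then 1 else 0) = 1\<^sub>m (2 * n)"
proof (rule eq_matI)
  fix i j assume "i < dim_row (1\<^sub>m (2 * n) :: complex mat)" "j < dim_col (1\<^sub>m (2 * n) :: complex mat)"
  then have ij: "i < 2 * n" "j < 2 * n" by auto
  have orth: "(\<Sum>\<zeta>\<in>negaroots n. \<zeta> ^ (j mod n) * cnj \<zeta> ^ (i mod n) / of_nat n) =
      (if i mod n = j mod n then 1 else 0)"
    unfolding sum_divide_distrib[symmetric]
    using n by (subst sum_negaroots_power_cnj[OF n]) simp_all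
  have "spectral n (\<lambda>\<zeta> s t. if s = t then 1 else 0) $$ (i, j) =
      (if i div n = j div n then \<Sum>\<zeta>\<in>negaroots n. \<zeta> ^ (j mod n) * cnj \<zeta> ^ (i mod n) / of_nat n else 0)"
    using ij by (simp add: spectral_def)
  also have "\<dots> = (if i = j then 1 else 0)"
    unfolding orth using div_mult_mod_eq[of i n] div_mult_mod_eq[of j n] by (metis (full_types))
  finally show "spectral n (\<lambda>\<zeta> s t. if s = t then 1 else 0) $$ (i, j) = 1\<^sub>m (2 * n) $$ (i, j)"
    using ij by simp
qed simp_all

lemma spectral_minus: "spectral n (\<lambda>\<zeta> s t. M \<zeta> s t - M' \<zeta> s t) = spectral n M - spectral n M'"
  unfolding spectral_def
  by (rule eq_matI) (auto simp: left_diff_distrib diff_divide_distrib sum_subtractf)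

text \<open>Each \<open>N n \<zeta>\<close> is self-adjoint, so the adjoint only affects the
  \<open>2 \<times> 2\<close> factors.\<close>

lemma spectral_adjoint: "mat_adjoint (spectral n M) = spectral n (\<lambda>\<zeta> s t. cnj (M \<zeta> t s))"
  by (rule eq_matI) (auto simp: mat_adjoint_def spectral_def mat_of_rows_def mult_ac)

text \<open>The matrices \<open>N n \<zeta>\<close> are mutually orthogonal idempotents, so
  different roots do not interact in a product.\<close>

lemma spectral_mult:
  assumes n: "n \<ge> 1"
  shows "spectral n M * spectral n M' = spectral n (\<lambda>\<zeta> s t. \<Sum>r<2. M \<zeta> s r * M' \<zeta> r t)"
proof (rule eq_matI)
  fix i j assume "i < dim_row (spectral n (\<lambda>\<zeta> s t. \<Sum>r<2. M \<zeta> s r * M' \<zeta> r t))"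
    "j < dim_col (spectral n (\<lambda>\<zeta> s t. \<Sum>r<2. M \<zeta> s r * M' \<zeta> r t))"
  then have ij: "i < 2 * n" "j < 2 * n" by auto
  \<comment> \<open>\<open>L\<close> collects the factors depending on the row \<open>i\<close>,
    \<open>K\<close> those depending on the column \<open>j\<close>, each with its own division by
    \<open>n\<close>.\<close>
  define L where "L \<zeta> r = M \<zeta> (i div n) r * cnj \<zeta> ^ (i mod n) / of_nat n" for \<zeta> r
  define K where "K \<zeta> r = M' \<zeta> r (j div n) * \<zeta> ^ (j mod n) / of_nat n" for \<zeta> r
  have "(spectral n M * spectral n M') $$ (i, j) =
      (\<Sum>k<2 * n. spectral n M $$ (i, k) * spectral n M' $$ (k, j))"
    using ij by (simp add: scalar_prod_def lessThan_atLeast0)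
  \<comment> \<open>The inner index is split into the block \<open>r\<close> and the position
    \<open>b\<close> within it.\<close>
  also have "\<dots> = (\<Sum>r<2. \<Sum>b<n. spectral n M $$ (i, b + r * n) * spectral n M' $$ (b + r * n, j))"
    by (rule sum_mult_product)
  also have "\<dots> = (\<Sum>r<2. \<Sum>b<n. (\<Sum>\<zeta>\<in>negaroots n. L \<zeta> r * \<zeta> ^ b) * (\<Sum>\<xi>\<in>negaroots n. K \<xi> r * cnj \<xi> ^ b))"
  proof (intro sum.cong refl)
    fix r b :: nat assume "r \<in> {..<2}" "b \<in> {..<n}"
    then have "b + r * n < 2 * n" "b < n" by (auto simp: less_2_cases_iff)
    then show "spectral n M $$ (i, b + r * n) * spectral n M' $$ (b + r * n, j) =
        (\<Sum>\<zeta>\<in>negaroots n. L \<zeta> r * \<zeta> ^ b) * (\<Sum>\<xi>\<in>negaroots n. K \<xi> r * cnj \<xi> ^ b)"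
      using ij by (simp add: spectral_def L_def K_def mult_ac)
  qed
  also have "\<dots> = (\<Sum>r<2. \<Sum>\<zeta>\<in>negaroots n. \<Sum>\<xi>\<in>negaroots n. L \<zeta> r * K \<xi> r * (\<Sum>b<n. \<zeta> ^ b * cnj \<xi> ^ b))"
  proof (intro sum.cong refl)
    fix r :: nat
    have "(\<Sum>b<n. (\<Sum>\<zeta>\<in>negaroots n. L \<zeta> r * \<zeta> ^ b) * (\<Sum>\<xi>\<in>negaroots n. K \<xi> r * cnj \<xi> ^ b)) =
        (\<Sum>b<n. \<Sum>\<zeta>\<in>negaroots n. \<Sum>\<xi>\<in>negaroots n. L \<zeta> r * K \<xi> r * (\<zeta> ^ b * cnj \<xi> ^ b))"
      by (simp add: sum_product mult_ac)
    also have "\<dots> = (\<Sum>\<zeta>\<in>negaroots n. \<Sum>b<n. \<Sum>\<xi>\<in>negaroots n. L \<zeta> r * K \<xi> r * (\<zeta> ^ b * cnj \<xi> ^ b))"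
      by (rule sum.swap)
    also have "\<dots> = (\<Sum>\<zeta>\<in>negaroots n. \<Sum>\<xi>\<in>negaroots n. \<Sum>b<n. L \<zeta> r * K \<xi> r * (\<zeta> ^ b * cnj \<xi> ^ b))"
      by (intro sum.cong refl sum.swap)
    finally show "(\<Sum>b<n. (\<Sum>\<zeta>\<in>negaroots n. L \<zeta> r * \<zeta> ^ b) * (\<Sum>\<xi>\<in>negaroots n. K \<xi> r * cnj \<xi> ^ b)) =
        (\<Sum>\<zeta>\<in>negaroots n. \<Sum>\<xi>\<in>negaroots n. L \<zeta> r * K \<xi> r * (\<Sum>b<n. \<zeta> ^ b * cnj \<xi> ^ b))"
      by (simp add: sum_distrib_left)
  qed
  \<comment> \<open>Only \<open>\<xi> = \<zeta>\<close> survives, and the resulting factor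
    \<open>n\<close> cancels one of the two divisions by \<open>n\<close>.\<close>
  also have "\<dots> = (\<Sum>r<2. \<Sum>\<zeta>\<in>negaroots n. L \<zeta> r * K \<zeta> r * of_nat n)"
    using finite_negaroots[OF n]
    by (intro sum.cong refl)
      (simp add: sum_power_negaroots[OF n] if_distrib[of "\<lambda>x. _ * x"] cong: if_cong)
  also have "\<dots> = (\<Sum>\<zeta>\<in>negaroots n. \<Sum>r<2. L \<zeta> r * K \<zeta> r * of_nat n)"
    by (rule sum.swap)
  also have "\<dots> = spectral n (\<lambda>\<zeta> s t. \<Sum>r<2. M \<zeta> s r * M' \<zeta> r t) $$ (i, j)"
    using ij n by (simp add: spectral_def L_def K_def sum_distrib_left sum_divide_distrib mult_ac)
  finally show "(spectral n M * spectral n M') $$ (i, j) =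
      spectral n (\<lambda>\<zeta> s t. \<Sum>r<2. M \<zeta> s r * M' \<zeta> r t) $$ (i, j)" .
qed auto

section \<open>Membership in \<open>PD n\<close> as a symmetry under conjugation of the root\<close>

text \<open>Transposing exchanges the exponents of \<open>\<zeta>\<close> and
  \<open>cnj \<zeta>\<close>, which amounts to reindexing the sum by conjugation.\<close>

lemma transpose_negacirc: "transpose_mat (negacirc n c) = negacirc n (\<lambda>\<zeta>. c (cnj \<zeta>))"
proof (rule eq_matI)
  fix a b assume "a < dim_row (negacirc n (\<lambda>\<zeta>. c (cnj \<zeta>)))" "b < dim_col (negacirc n (\<lambda>\<zeta>. c (cnj \<zeta>)))"
  then show "transpose_mat (negacirc n c) $$ (a, b) = negacirc n (\<lambda>\<zeta>. c (cnj \<zeta>)) $$ (a, b)"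
    using sum_negaroots_cnj[of "\<lambda>\<zeta>. c \<zeta> * \<zeta> ^ a * cnj \<zeta> ^ b / of_nat n" n]
    by (simp add: negacirc_def mult_ac)
qed (simp_all add: negacirc_def)

lemma four_block_negacirc:
  "four_block_mat (negacirc n a) (negacirc n b) (negacirc n c) (negacirc n d) =
    spectral n (\<lambda>\<zeta> s t. if s = 0 then if t = 0 then a \<zeta> else b \<zeta> else if t = 0 then c \<zeta> else d \<zeta>)"
proof -
  have div_mod: "i div n = 1 \<and> i mod n = i - n" if "i < 2 * n" "\<not> i < n" for i
    using that by (simp add: div_if mod_if)
  show ?thesis
    by (rule eq_matI)
      (auto simp: negacirc_def spectral_def four_block_mat_def Let_def div_mod)
qed

text \<open>By \<open>transpose_negacirc\<close> the lower blocks carry the coefficients of the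
  upper ones at \<open>cnj \<zeta>\<close>. The map \<open>1 - s\<close> on \<open>{0, 1}\<close> is
  the coordinate swap.\<close>

lemma PD_iff:
  assumes n: "n \<ge> 1"
  shows "X \<in> PD n \<longleftrightarrow> (\<exists>M. X = spectral n M \<and>
    (\<forall>\<zeta>\<in>negaroots n. \<forall>s<2. \<forall>t<2. M (cnj \<zeta>) (1 - s) (1 - t) = M \<zeta> s t))"
    (is "_ \<longleftrightarrow> (\<exists>M. _ \<and> ?sym M)")
proof
  assume "X \<in> PD n"
  then obtain A B where AB: "negacirculant n A" "negacirculant n B"
    and X: "X = four_block_mat A B (transpose_mat B) (transpose_mat A)"
    unfolding PD_def by blast
  obtain a b where ab: "A = negacirc n a" "B = negacirc n b"
    using AB unfolding negacirculant_iff[OF n] by blast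
  define M where "M = (\<lambda>\<zeta> s t. if s = (0::nat) then if t = (0::nat) then a \<zeta> else b \<zeta>
    else if t = 0 then b (cnj \<zeta>) else a (cnj \<zeta>))"
  have "X = spectral n M"
    unfolding X ab transpose_negacirc four_block_negacirc M_def ..
  moreover have "?sym M"
    by (auto simp: M_def less_2_cases_iff)
  ultimately show "\<exists>M. X = spectral n M \<and> ?sym M" by blast
next
  assume "\<exists>M. X = spectral n M \<and> ?sym M"
  then obtain M where X: "X = spectral n M" and sym: "?sym M" by blast
  \<comment> \<open>The symmetry determines the second row of each \<open>M \<zeta>\<close>, so the
    first row suffices to define the blocks.\<close>
  define A B where "A = negacirc n (\<lambda>\<zeta>. M \<zeta> 0 0)" and "B = negacirc n (\<lambda>\<zeta>. M \<zeta> 0 1)"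
  have "four_block_mat A B (transpose_mat B) (transpose_mat A) = X"
    unfolding A_def B_def transpose_negacirc four_block_negacirc X
  proof (rule spectral_cong)
    fix \<zeta> s t assume "\<zeta> \<in> negaroots n" "s < (2::nat)" "t < (2::nat)"
    then show "(if s = 0 then if t = 0 then M \<zeta> 0 0 else M \<zeta> 0 1
        else if t = 0 then M (cnj \<zeta>) 0 1 else M (cnj \<zeta>) 0 0) = M \<zeta> s t"
      using sym by (force simp: less_2_cases_iff)
  qed
  moreover have "negacirculant n A" "negacirculant n B"
    unfolding negacirculant_iff[OF n] A_def B_def by blast+
  ultimately show "X \<in> PD n" unfolding PD_def by blast
qed

section \<open>The matrix \<open>X_mat\<close> in spectral form\<close>

text \<open>The column \<open>(u, v)\<close> times its adjoint; for a unit vector this is the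
  orthogonal projection onto its span. Every nonzero index is read as \<open>1\<close>.\<close>

definition outer :: "complex \<Rightarrow> complex \<Rightarrow> nat \<Rightarrow> nat \<Rightarrow> complex" where
  "outer u v s t = (if s = 0 then u else v) * cnj (if t = 0 then u else v)"

lemma outer_swap: "s < 2 \<Longrightarrow> t < 2 \<Longrightarrow> outer u v (1 - s) (1 - t) = outer v u s t"
  by (auto simp: outer_def less_2_cases_iff)

text \<open>The sign \<open>chi\<close> and the reduction of the exponent modulo \<open>n\<close>
  compensate each other, which exhibits \<open>N n \<zeta>\<close> as a product of a column and a
  row.\<close>

lemma N_index:
  assumes n: "n \<ge> 1" and R: "\<zeta> \<in> negaroots n" and ij: "i < n" "j < n"
  shows "N n \<zeta> $$ (i, j) = \<zeta> ^ j * cnj \<zeta> ^ i / of_nat n"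
proof (cases "i \<le> j")
  case True
  then have "(int j - int i) mod int n = int (j - i)"
    using ij by simp
  then show ?thesis
    using True ij negaroots_power_shift[OF n R True] by (simp add: N_def chi_def nat_diff_distrib)
next
  case False
  have "(int j - int i) mod int n = (int j - int i + int n) mod int n" by simp
  also have "\<dots> = int (n + j - i)"
    using False ij by (subst mod_pos_pos_trivial) simp_all
  finally have "nat ((int j - int i) mod int n) = n + j - i"
    by (simp only: nat_int)
  then show ?thesis
    using False ij negaroots_power_shift'[OF n R, of j i] by (simp add: N_def chi_def)
qed

text \<open>This gives access to the entries of the two algebraic sums in
  \<open>X_mat\<close>.\<close>

lemma finsum_module_mat:
  fixes f :: "'b \<Rightarrow> 'a :: comm_ring_1 mat"
  assumes "finite S" "f \<in> S \<rightarrow> carrier_mat nr nc"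
  shows "finsum (module_mat TYPE('a) nr nc) f S = mat nr nc (\<lambda>(i, j). \<Sum>x\<in>S. f x $$ (i, j))"
proof -
  interpret abelian_group "module_mat TYPE('a) nr nc" by (rule abelian_group_mat)
  show ?thesis
    using assms
  proof (induction S rule: finite_induct)
    case empty
    show ?case
      unfolding finsum_empty by (rule eq_matI) (simp_all add: module_mat_simps)
  next
    case (insert x S)
    have f: "f \<in> S \<rightarrow> carrier (module_mat TYPE('a) nr nc)" "f x \<in> carrier (module_mat TYPE('a) nr nc)"
      using insert.prems by (auto simp: module_mat_simps)
    have "finsum (module_mat TYPE('a) nr nc) f (insert x S) = f x + mat nr nc (\<lambda>(i, j). \<Sum>x\<in>S. f x $$ (i, j))"
      using finsum_insert[OF insert.hyps f] insert by (auto simp: module_mat_simps)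
    then show ?case
      using insert.hyps insert.prems by (intro eq_matI) auto
  qed
qed

lemma X_mat_eq_spectral:
  assumes n: "n \<ge> 1" and sub: "H \<subseteq> negaroots n" "F \<subseteq> negaroots n" and disj: "H \<inter> F = {}"
  shows "X_mat n H F u v = spectral n (\<lambda>\<zeta> s t. if \<zeta> \<in> H then outer (u \<zeta>) (v \<zeta>) s t
    else if \<zeta> \<in> F then if s = t then 1 else 0 else 0)" (is "_ = spectral n ?M")
proof -
  define P where "P = (\<lambda>\<zeta>. mat_of_rows_list 2
              [[u \<zeta> * cnj (u \<zeta>), u \<zeta> * cnj (v \<zeta>)],
               [v \<zeta> * cnj (u \<zeta>), v \<zeta> * cnj (v \<zeta>)]] \<otimes>\<^sub>K N n \<zeta>)"
  define Q where "Q = (\<lambda>\<zeta>. 1\<^sub>m 2 \<otimes>\<^sub>K N n \<zeta>)"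
  define E where "E \<zeta> i j = \<zeta> ^ (j mod n) * cnj \<zeta> ^ (i mod n) / complex_of_nat n" for \<zeta> i j
  have fin: "finite H" "finite F"
    using sub finite_negaroots[OF n] finite_subset by auto
  have carr: "P \<in> H \<rightarrow> carrier_mat (2 * n) (2 * n)" "Q \<in> F \<rightarrow> carrier_mat (2 * n) (2 * n)"
    by (auto simp: P_def Q_def kronecker_def mat_of_rows_list_def N_def)
  have P: "P \<zeta> $$ (i, j) = outer (u \<zeta>) (v \<zeta>) (i div n) (j div n) * E \<zeta> i j"
    if "\<zeta> \<in> H" "i < 2 * n" "j < 2 * n" for \<zeta> i j
    using that n sub N_index[OF n, of \<zeta> "i mod n" "j mod n"] div_less_2[of i n] div_less_2[of j n]
    by (auto simp: P_def E_def kronecker_def mat_of_rows_list_def outer_def N_def less_2_cases_iff)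
  have Q: "Q \<zeta> $$ (i, j) = (if i div n = j div n then 1 else 0) * E \<zeta> i j"
    if "\<zeta> \<in> F" "i < 2 * n" "j < 2 * n" for \<zeta> i j
    using that n sub N_index[OF n, of \<zeta> "i mod n" "j mod n"] div_less_2[of i n] div_less_2[of j n]
    by (auto simp: Q_def E_def kronecker_def N_def)
  show ?thesis
  proof (rule eq_matI)
    fix i j assume "i < dim_row (spectral n ?M)" "j < dim_col (spectral n ?M)"
    then have ij: "i < 2 * n" "j < 2 * n" by auto
    have "X_mat n H F u v $$ (i, j) = (\<Sum>\<zeta>\<in>H. P \<zeta> $$ (i, j)) + (\<Sum>\<zeta>\<in>F. Q \<zeta> $$ (i, j))"
      using ij unfolding X_mat_def P_def[symmetric] Q_def[symmetric]
        finsum_module_mat[OF fin(1) carr(1)] finsum_module_mat[OF fin(2) carr(2)] by simp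
    also have "\<dots> = (\<Sum>\<zeta>\<in>H. ?M \<zeta> (i div n) (j div n) * E \<zeta> i j) + (\<Sum>\<zeta>\<in>F. ?M \<zeta> (i div n) (j div n) * E \<zeta> i j)"
      using ij disj by (intro arg_cong2[where f = "(+)"] sum.cong refl) (auto simp: P Q)
    also have "\<dots> = (\<Sum>\<zeta>\<in>H \<union> F. ?M \<zeta> (i div n) (j div n) * E \<zeta> i j)"
      using fin disj by (simp add: sum.union_disjoint)
    \<comment> \<open>Outside \<open>H \<union> F\<close> the coefficient is \<open>0\<close>, so
      the sum extends to all roots.\<close>
    also have "\<dots> = (\<Sum>\<zeta>\<in>negaroots n. ?M \<zeta> (i div n) (j div n) * E \<zeta> i j)"
      using sub finite_negaroots[OF n] by (intro sum.mono_neutral_left) auto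
    also have "\<dots> = spectral n ?M $$ (i, j)"
      using ij by (simp add: spectral_def E_def mult_ac)
    finally show "X_mat n H F u v $$ (i, j) = spectral n ?M $$ (i, j)" .
  qed (simp_all add: X_mat_def P_def[symmetric] Q_def[symmetric]
      finsum_module_mat[OF fin(1) carr(1)] finsum_module_mat[OF fin(2) carr(2)])
qed

section \<open>Rank of a sum over the roots\<close>

text \<open>Each product of a column and a row has rank at most \<open>1\<close>, and rank is
  subadditive.\<close>

lemma rank_sum_outer_le:
  fixes f g :: "'b \<Rightarrow> nat \<Rightarrow> 'a :: field"
  assumes "finite K"
  shows "vec_space.rank m (mat m nc (\<lambda>(i, j). \<Sum>k\<in>K. f k i * g k j)) \<le> card K"
proof -
  interpret vec_space "TYPE('a)" m .
  show ?thesis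
    using assms
  proof (induction K rule: finite_induct)
    case empty
    have "mat m nc (\<lambda>(i, j). \<Sum>k\<in>{}. f k i * g k j) = 0\<^sub>m m nc" by (rule eq_matI) auto
    then show ?case using rank_0I[of nc] by (simp only: card.empty le_refl)
  next
    case (insert x K)
    have "mat m nc (\<lambda>(i, j). \<Sum>k\<in>insert x K. f k i * g k j) =
        mat m nc (\<lambda>(i, j). f x i * g x j) + mat m nc (\<lambda>(i, j). \<Sum>k\<in>K. f k i * g k j)"
      using insert.hyps by (intro eq_matI) auto
    moreover have "rank (mat m nc (\<lambda>(i, j). f x i * g x j)) \<le> 1"
      by (rule rank_le_1_product_entries[where f = "f x" and g = "g x"]) auto
    ultimately show ?case
      using insert rank_subadditive[of "mat m nc (\<lambda>(i, j). f x i * g x j)" nc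
          "mat m nc (\<lambda>(i, j). \<Sum>k\<in>K. f k i * g k j)"] by simp
  qed
qed

text \<open>Rank at most \<open>k\<close> is encoded as a sum of \<open>k\<close> products because
  that is the form in which the terms can be fed to \<open>rank_sum_outer_le\<close>.\<close>

definition rank_le_on2 :: "nat \<Rightarrow> (nat \<Rightarrow> nat \<Rightarrow> complex) \<Rightarrow> bool" where
  "rank_le_on2 k A \<longleftrightarrow> (\<exists>x y. \<forall>s<2. \<forall>t<2. A s t = (\<Sum>l<k. x l s * y l t))"

text \<open>As \<open>N n \<zeta>\<close> is itself a column times a row, each rank-one term of
  \<open>M \<zeta>\<close> yields one rank-one term of the whole matrix.\<close>

lemma rank_spectral_le:
  assumes n: "n \<ge> 1" and M: "\<And>\<zeta>. \<zeta> \<in> negaroots n \<Longrightarrow> rank_le_on2 (r \<zeta>) (M \<zeta>)"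
  shows "vec_space.rank (2 * n) (spectral n M) \<le> (\<Sum>\<zeta>\<in>negaroots n. r \<zeta>)"
proof -
  have "\<exists>x y. \<forall>\<zeta>\<in>negaroots n. \<forall>s<2. \<forall>t<2. M \<zeta> s t = (\<Sum>l<r \<zeta>. x \<zeta> l s * y \<zeta> l t)"
    using M unfolding rank_le_on2_def by metis
  then obtain x y where xy:
    "\<And>\<zeta> s t. \<zeta> \<in> negaroots n \<Longrightarrow> s < 2 \<Longrightarrow> t < 2 \<Longrightarrow> M \<zeta> s t = (\<Sum>l<r \<zeta>. x \<zeta> l s * y \<zeta> l t)"
    by blast
  \<comment> \<open>\<open>K\<close> indexes all rank-one terms; \<open>f\<close> and
    \<open>g\<close> are their columns and rows.\<close>
  define K where "K = Sigma (negaroots n) (\<lambda>\<zeta>. {..<r \<zeta>})"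
  define f where "f = (\<lambda>(\<zeta>, l) i. x \<zeta> l (i div n) * cnj \<zeta> ^ (i mod n))"
  define g where "g = (\<lambda>(\<zeta>, l) j. y \<zeta> l (j div n) * \<zeta> ^ (j mod n) / of_nat n)"
  have "spectral n M = mat (2 * n) (2 * n) (\<lambda>(i, j). \<Sum>k\<in>K. f k i * g k j)"
  proof (rule eq_matI)
    fix i j assume "i < dim_row (mat (2 * n) (2 * n) (\<lambda>(i, j). \<Sum>k\<in>K. f k i * g k j))"
      "j < dim_col (mat (2 * n) (2 * n) (\<lambda>(i, j). \<Sum>k\<in>K. f k i * g k j))"
    then have ij: "i < 2 * n" "j < 2 * n" by auto
    have "spectral n M $$ (i, j) = (\<Sum>\<zeta>\<in>negaroots n. \<Sum>l<r \<zeta>. f (\<zeta>, l) i * g (\<zeta>, l) j)"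
      using ij by (simp add: spectral_def f_def g_def xy div_less_2 sum_distrib_left
        sum_divide_distrib mult_ac)
    also have "\<dots> = (\<Sum>k\<in>K. f k i * g k j)"
      unfolding K_def using finite_negaroots[OF n] by (subst sum.Sigma) (auto intro: sum.cong)
    finally show "spectral n M $$ (i, j) = mat (2 * n) (2 * n) (\<lambda>(i, j). \<Sum>k\<in>K. f k i * g k j) $$ (i, j)"
      using ij by simp
  qed simp_all
  moreover have "finite K" unfolding K_def using finite_negaroots[OF n] by auto
  moreover have "card K = (\<Sum>\<zeta>\<in>negaroots n. r \<zeta>)"
    unfolding K_def using finite_negaroots[OF n] by simp
  ultimately show ?thesis using rank_sum_outer_le[of K "2 * n" "2 * n" f g] by simp
qed

text \<open>The upper bounds for \<open>X\<close> and \<open>1 - X\<close> add up to \<open>2 n\<close>, so subadditivity forces equality in both.\<close>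

lemma rank_spectral:
  assumes n: "n \<ge> 1" and r: "\<And>\<zeta>. \<zeta> \<in> negaroots n \<Longrightarrow> r \<zeta> \<le> 2"
    and M: "\<And>\<zeta>. \<zeta> \<in> negaroots n \<Longrightarrow> rank_le_on2 (r \<zeta>) (M \<zeta>)"
    and M': "\<And>\<zeta>. \<zeta> \<in> negaroots n \<Longrightarrow> rank_le_on2 (2 - r \<zeta>) (\<lambda>s t. (if s = t then 1 else 0) - M \<zeta> s t)"
  shows "vec_space.rank (2 * n) (spectral n M) = (\<Sum>\<zeta>\<in>negaroots n. r \<zeta>)"
proof -
  interpret vec_space "TYPE(complex)" "2 * n" .
  \<comment> \<open>The truncated subtraction is exact because \<open>r \<zeta> \<le> 2\<close>, so
    each of the \<open>n\<close> roots contributes \<open>2\<close>.\<close>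
  have sum: "(\<Sum>\<zeta>\<in>negaroots n. r \<zeta>) + (\<Sum>\<zeta>\<in>negaroots n. 2 - r \<zeta>) = 2 * n"
    using r card_negaroots[OF n] by (simp add: sum.distrib[symmetric])
  define M1 where "M1 \<zeta> s t = (if s = t then 1 else 0) - M \<zeta> s t" for \<zeta> s t
  have "spectral n M + spectral n M1 = 1\<^sub>m (2 * n)"
    unfolding M1_def spectral_minus spectral_one[OF n]
    by (rule eq_matI) (auto simp: spectral_def)
  moreover have "rank (1\<^sub>m (2 * n)) = 2 * n"
    by (rule low_rank_det_zero) auto
  ultimately have "2 * n \<le> rank (spectral n M) + rank (spectral n M1)"
    using rank_subadditive[of "spectral n M" "2 * n" "spectral n M1"] by simp
  moreover have "rank (spectral n M) \<le> (\<Sum>\<zeta>\<in>negaroots n. r \<zeta>)"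
    using n M by (rule rank_spectral_le)
  moreover have "rank (spectral n M1) \<le> (\<Sum>\<zeta>\<in>negaroots n. 2 - r \<zeta>)"
    using n M' unfolding M1_def by (rule rank_spectral_le)
  ultimately show ?thesis using sum by linarith
qed

lemma rank_le_on2_zero: "rank_le_on2 0 (\<lambda>s t. 0)"
  by (simp add: rank_le_on2_def)

lemma rank_le_on2_one: "rank_le_on2 2 (\<lambda>s t. if s = t then 1 else 0)"
  unfolding rank_le_on2_def
  by (rule exI[where x = "\<lambda>l s. if s = l then 1 else 0"], rule exI[where x = "\<lambda>l s. if s = l then 1 else 0"])
    (auto simp: less_2_cases_iff numeral_2_eq_2)

lemma rank_le_on2_outer: "rank_le_on2 1 (outer u v)"
  unfolding rank_le_on2_def outer_def
  by (rule exI[where x = "\<lambda>l s. if s = 0 then u else v"], rule exI[where x = "\<lambda>l t. cnj (if t = 0 then u else v)"])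
    simp

lemma rank_le_on2_cong:
  assumes "\<And>s t. s < 2 \<Longrightarrow> t < 2 \<Longrightarrow> A s t = B s t"
  shows "rank_le_on2 k A \<longleftrightarrow> rank_le_on2 k B"
  using assms by (simp add: rank_le_on2_def)

text \<open>The vector \<open>(- cnj v, cnj u)\<close> spans the orthogonal complement of \<open>(u, v)\<close>.\<close>

lemma one_minus_outer:
  assumes "(cmod v)\<^sup>2 + (cmod u)\<^sup>2 = 1" "s < 2" "t < 2"
  shows "(if s = t then 1 else 0) - outer u v s t = outer (- cnj v) (cnj u) s t"
proof -
  have "u * cnj u + v * cnj v = 1"
    using assms(1) by (metis add.commute complex_norm_square of_real_1 of_real_add)
  then show ?thesis
    using assms(2,3) by (auto simp: outer_def less_2_cases_iff algebra_simps)
qed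

text \<open>Blocks have rank \<open>1\<close>, \<open>2\<close>, \<open>0\<close> on
  \<open>H\<close>, \<open>F\<close>, \<open>C\<close>. Passing to the complement exchanges
  \<open>2\<close> and \<open>0\<close>, and on \<open>H\<close> it gives the projection onto the
  orthogonal line.\<close>

lemma rank_spectral_partition:
  assumes n: "n \<ge> 1" and R: "H \<union> F \<union> C = negaroots n"
    and disj: "H \<inter> F = {}" "H \<inter> C = {}" "F \<inter> C = {}"
    and unit: "\<And>\<zeta>. \<zeta> \<in> H \<Longrightarrow> (cmod (v \<zeta>))\<^sup>2 + (cmod (u \<zeta>))\<^sup>2 = 1"
  shows "vec_space.rank (2 * n) (spectral n (\<lambda>\<zeta> s t. if \<zeta> \<in> H then outer (u \<zeta>) (v \<zeta>) s t
    else if \<zeta> \<in> F then if s = t then 1 else 0 else 0)) = card H + 2 * card F"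
    (is "vec_space.rank _ (spectral n ?M) = _")
proof -
  have fin: "finite H" "finite F" "finite C"
    using R finite_negaroots[OF n] by (metis finite_Un)+
  define r :: "complex \<Rightarrow> nat" where "r \<zeta> = (if \<zeta> \<in> H then 1 else if \<zeta> \<in> F then 2 else 0)" for \<zeta>
  have "vec_space.rank (2 * n) (spectral n ?M) = (\<Sum>\<zeta>\<in>negaroots n. r \<zeta>)"
  proof (rule rank_spectral[OF n])
    fix \<zeta> assume "\<zeta> \<in> negaroots n"
    show "r \<zeta> \<le> 2" by (simp add: r_def)
    show "rank_le_on2 (r \<zeta>) (?M \<zeta>)"
      using rank_le_on2_zero rank_le_on2_one rank_le_on2_outer[of "u \<zeta>" "v \<zeta>"]
      by (simp add: r_def)
    show "rank_le_on2 (2 - r \<zeta>) (\<lambda>s t. (if s = t then 1 else 0) - ?M \<zeta> s t)"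
    proof (cases "\<zeta> \<in> H")
      case True
      then show ?thesis
        using rank_le_on2_outer[of "- cnj (v \<zeta>)" "cnj (u \<zeta>)"]
          rank_le_on2_cong[OF one_minus_outer[OF unit[OF True]]] by (simp add: r_def)
    next
      case False
      then show ?thesis
        using rank_le_on2_zero rank_le_on2_one by (simp add: r_def)
    qed
  qed
  also have "\<dots> = (\<Sum>\<zeta>\<in>H. r \<zeta>) + (\<Sum>\<zeta>\<in>F. r \<zeta>) + (\<Sum>\<zeta>\<in>C. r \<zeta>)"
    unfolding R[symmetric] using fin disj
    by (subst sum.union_disjoint; (subst sum.union_disjoint)?) auto
  also have "\<dots> = (\<Sum>\<zeta>\<in>H. 1) + (\<Sum>\<zeta>\<in>F. 2) + (\<Sum>\<zeta>\<in>C. 0)"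
    using disj by (intro arg_cong2[where f = "(+)"] sum.cong refl) (auto simp: r_def)
  finally show ?thesis by simp
qed

section \<open>Self-adjoint idempotents and their \<open>2 \<times> 2\<close> blocks\<close>

lemma self_adjoint_idempotent_spectral_iff:
  assumes n: "n \<ge> 1"
  shows "self_adjoint_idempotent_of_rank (2 * n) k (spectral n M) \<longleftrightarrow>
    (\<forall>\<zeta>\<in>negaroots n. \<forall>s<2. \<forall>t<2. cnj (M \<zeta> t s) = M \<zeta> s t) \<and>
    (\<forall>\<zeta>\<in>negaroots n. \<forall>s<2. \<forall>t<2. (\<Sum>r<2. M \<zeta> s r * M \<zeta> r t) = M \<zeta> s t) \<and>
    vec_space.rank (2 * n) (spectral n M) = k"
  unfolding self_adjoint_idempotent_of_rank_def spectral_adjoint spectral_mult[OF n] spectral_eq_iff[OF n]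
  by simp

text \<open>The inner factor of the product is the squared norm of \<open>(u, v)\<close>.\<close>

lemma outer_idempotent:
  assumes "(cmod v)\<^sup>2 + (cmod u)\<^sup>2 = 1"
  shows "(\<Sum>r<2. outer u v s r * outer u v r t) = outer u v s t"
proof -
  have unit: "cnj u * u + cnj v * v = 1"
    using assms by (metis add.commute complex_norm_square mult.commute of_real_1 of_real_add)
  have "(\<Sum>r<2. outer u v s r * outer u v r t) =
      (if s = 0 then u else v) * (cnj u * u + cnj v * v) * cnj (if t = 0 then u else v)"
    by (simp add: outer_def numeral_2_eq_2 algebra_simps)
  then show ?thesis by (simp add: unit outer_def)
qed

text \<open>Each case also records the trace, which equals the rank of a projection and later tells
  the three kinds of roots apart.\<close>

lemma projection_2x2_cases:
  assumes adj: "\<And>s t. s < 2 \<Longrightarrow> t < 2 \<Longrightarrow> cnj (A t s) = A s t"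
    and idem: "\<And>s t. s < 2 \<Longrightarrow> t < 2 \<Longrightarrow> (\<Sum>r<2. A s r * A r t) = A s t"
  obtains
    (zero) "A 0 0 + A 1 1 = 0" "\<And>s t. s < 2 \<Longrightarrow> t < 2 \<Longrightarrow> A s t = 0"
  | (one) "A 0 0 + A 1 1 = 2" "\<And>s t. s < 2 \<Longrightarrow> t < 2 \<Longrightarrow> A s t = (if s = t then 1 else 0)"
  | (outer) u v where "A 0 0 + A 1 1 = 1" "(cmod v)\<^sup>2 + (cmod u)\<^sup>2 = 1"
      "\<And>s t. s < 2 \<Longrightarrow> t < 2 \<Longrightarrow> A s t = outer u v s t"
proof -
  define \<alpha> \<delta> b where "\<alpha> = Re (A 0 0)" and "\<delta> = Re (A 1 1)" and "b = A 0 1"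
  have A: "A 0 0 = of_real \<alpha>" "A 1 1 = of_real \<delta>" "A 1 0 = cnj b" "A 0 1 = b"
    using adj[of 0 0] adj[of 1 1] adj[of 1 0] by (auto simp: \<alpha>_def \<delta>_def b_def complex_eq_iff)
  have "of_real \<alpha> * of_real \<alpha> + b * cnj b = complex_of_real \<alpha>"
    using idem[of 0 0] A by (simp add: numeral_2_eq_2)
  then have \<alpha>: "\<alpha> * \<alpha> + (cmod b)\<^sup>2 = \<alpha>"
    unfolding complex_norm_square[symmetric] by (metis of_real_add of_real_eq_iff of_real_mult)
  have "b * cnj b + of_real \<delta> * of_real \<delta> = complex_of_real \<delta>"
    using idem[of 1 1] A by (simp add: numeral_2_eq_2 mult.commute)
  then have \<delta>: "(cmod b)\<^sup>2 + \<delta> * \<delta> = \<delta>"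
    unfolding complex_norm_square[symmetric] by (metis of_real_add of_real_eq_iff of_real_mult)
  have "of_real \<alpha> * b + b * of_real \<delta> = b"
    using idem[of 0 1] A by (simp add: numeral_2_eq_2)
  \<comment> \<open>The off-diagonal entry of \<open>A * A = A\<close> forces either a diagonal
    matrix or trace \<open>1\<close>.\<close>
  then have "b * of_real (\<alpha> + \<delta> - 1) = 0" by (simp add: algebra_simps)
  then have b: "b = 0 \<or> \<alpha> + \<delta> = 1" by (metis diff_add_cancel add_0 mult_eq_0_iff of_real_eq_0_iff)
  show thesis
  proof (cases "b = 0")
    case True
    then have "\<alpha> = 0 \<or> \<alpha> = 1" "\<delta> = 0 \<or> \<delta> = 1" using \<alpha> \<delta> by auto
    then consider "\<alpha> = 0" "\<delta> = 0" | "\<alpha> = 1" "\<delta> = 1" | "\<alpha> = 1" "\<delta> = 0" | "\<alpha> = 0" "\<delta> = 1" by blast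
    then show thesis
    proof cases
      case 1
      then show thesis using A True by (intro zero) (auto simp: less_2_cases_iff)
    next
      case 2
      then show thesis using A True by (intro one) (auto simp: less_2_cases_iff)
    next
      case 3
      \<comment> \<open>\<open>v\<close> occurs before \<open>u\<close> in the premises of the case,
        so this instantiates \<open>v\<close> with \<open>0\<close> and \<open>u\<close> with
        \<open>1\<close>.\<close>
      then show thesis using A True by (intro outer[of 0 1]) (auto simp: less_2_cases_iff outer_def)
    next
      case 4
      then show thesis using A True by (intro outer[of 1 0]) (auto simp: less_2_cases_iff outer_def)
    qed
  next
    case False
    have \<delta>': "\<delta> = 1 - \<alpha>" using b False by simp
    have pos: "\<alpha> > 0"
      using False \<alpha> by (smt (verit) zero_le_square zero_less_norm_iff zero_less_power)
    \<comment> \<open>The vector is the first column \<open>(\<alpha>, cnj b)\<close> of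
      \<open>A\<close> divided by \<open>sqrt \<alpha>\<close>.\<close>
    define u v where "u = complex_of_real (sqrt \<alpha>)" and "v = cnj b / complex_of_real (sqrt \<alpha>)"
    have sq: "complex_of_real (sqrt \<alpha>) * complex_of_real (sqrt \<alpha>) = of_real \<alpha>"
      using pos by (simp flip: of_real_mult)
    have cu: "(cmod u)\<^sup>2 = \<alpha>" using pos by (simp add: u_def)
    have "(cmod b)\<^sup>2 = \<alpha> * (1 - \<alpha>)" using \<alpha> by (simp add: algebra_simps)
    then have cv: "(cmod v)\<^sup>2 = \<delta>"
      using pos by (simp add: v_def norm_divide power_divide \<delta>')
    have "u * cnj u = of_real \<alpha>" "v * cnj v = of_real \<delta>"
      using cu cv by (simp_all flip: complex_norm_square)
    moreover have "u * cnj v = b" "v * cnj u = cnj b"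
      using pos by (simp_all add: u_def v_def)
    ultimately show thesis
      using A cu cv \<delta>' by (intro outer[of v u]) (auto simp: less_2_cases_iff outer_def)
  qed
qed

section \<open>The real root and the two directions of the correspondence\<close>

text \<open>A real number of modulus \<open>1\<close> is \<open>1\<close> or \<open>-1\<close>, and
  \<open>1\<close> is not a root of \<open>-1\<close>. Hence \<open>-1\<close> is the only possible
  root fixed by conjugation.\<close>

lemma negaroots_real:
  assumes n: "n \<ge> 1" and R: "\<zeta> \<in> negaroots n" and "Im \<zeta> = 0"
  shows "\<zeta> = -1"
proof -
  have "\<zeta> * \<zeta> = 1"
    using negaroots_mult_cnj[OF n R] assms(3) by (simp add: complex_eq_iff)
  then have "\<zeta> = 1 \<or> \<zeta> = -1" by (simp add: square_eq_1_iff)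
  then show ?thesis using R by (auto simp: negaroots_def)
qed

text \<open>At \<open>-1\<close> the norm condition follows from two entries of modulus
  \<open>1 / sqrt 2\<close>.\<close>

lemma unit_vector_choice_norm:
  assumes "unit_vector_choice H u v" "\<zeta> \<in> H"
  shows "(cmod (v \<zeta>))\<^sup>2 + (cmod (u \<zeta>))\<^sup>2 = 1"
proof (cases "\<zeta> = -1")
  case True
  then have "(cmod (u \<zeta>))\<^sup>2 = 1 / 2" "cmod (v \<zeta>) = cmod (u \<zeta>)"
    using assms by (auto simp: unit_vector_choice_def norm_divide power_divide)
  then show ?thesis by simp
next
  case False
  then show ?thesis using assms unfolding unit_vector_choice_def by blast
qed

theorem theorem4p9:
  fixes n :: nat
  assumes "n \<ge> 1"
  shows "(\<forall>H F C u v. root_partition n H F C \<and> unit_vector_choice H u v \<longrightarrow>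
            X_mat n H F u v \<in> PD n \<and>
            self_adjoint_idempotent_of_rank (2 * n) n (X_mat n H F u v))
       \<and> (\<forall>X \<in> PD n. self_adjoint_idempotent_of_rank (2 * n) n X \<longrightarrow>
            (\<exists>H F C u v. root_partition n H F C \<and> unit_vector_choice H u v \<and>
               X = X_mat n H F u v))"
proof (intro conjI allI impI ballI)
  fix H F C u v
  assume hyp: "root_partition n H F C \<and> unit_vector_choice H u v"
  then have R: "H \<union> F \<union> C = negaroots n" and disj: "H \<inter> F = {}" "H \<inter> C = {}" "F \<inter> C = {}"
    and card: "card F = card C"
    and cnj: "\<And>\<zeta>. \<zeta> \<in> H \<Longrightarrow> cnj \<zeta> \<in> H" "\<And>\<zeta>. \<zeta> \<in> F \<Longrightarrow> cnj \<zeta> \<in> F"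
    unfolding root_partition_def mu_diff_eq_negaroots by auto
  have cnj_iff: "cnj \<zeta> \<in> H \<longleftrightarrow> \<zeta> \<in> H" "cnj \<zeta> \<in> F \<longleftrightarrow> \<zeta> \<in> F" for \<zeta>
    using cnj(1)[of \<zeta>] cnj(1)[of "cnj \<zeta>"] cnj(2)[of \<zeta>] cnj(2)[of "cnj \<zeta>"] by auto
  have uv: "(cmod (v \<zeta>))\<^sup>2 + (cmod (u \<zeta>))\<^sup>2 = 1" "v (cnj \<zeta>) = u \<zeta>" "u (cnj \<zeta>) = v \<zeta>"
    if "\<zeta> \<in> H" "\<zeta> \<noteq> -1" for \<zeta>
    using hyp that unfolding unit_vector_choice_def by auto
  have uv1: "u (-1) = of_real (1 / sqrt 2)" "v (-1) = u (-1) \<or> v (-1) = - u (-1)" if "-1 \<in> H"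
    using hyp that unfolding unit_vector_choice_def by auto
  have unit: "(cmod (v \<zeta>))\<^sup>2 + (cmod (u \<zeta>))\<^sup>2 = 1" if "\<zeta> \<in> H" for \<zeta>
    using hyp that unit_vector_choice_norm by blast
  define M where "M = (\<lambda>\<zeta> s t. if \<zeta> \<in> H then outer (u \<zeta>) (v \<zeta>) s t
    else if \<zeta> \<in> F then if s = t then 1 else 0 else 0)"
  have X: "X_mat n H F u v = spectral n M"
    unfolding M_def using assms R disj(1) by (intro X_mat_eq_spectral) auto
  have "M (cnj \<zeta>) (1 - s) (1 - t) = M \<zeta> s t"
    if st: "s < 2" "t < 2" for \<zeta> s t
  proof (cases "\<zeta> \<in> H")
    case True
    have "outer (u (cnj \<zeta>)) (v (cnj \<zeta>)) (1 - s) (1 - t) = outer (u \<zeta>) (v \<zeta>) s t"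
    proof (cases "\<zeta> = -1")
      \<comment> \<open>The root is its own conjugate, and \<open>v (-1)\<close> being
        \<open>u (-1)\<close> up to sign makes the block invariant under the swap.\<close>
      case minus_one: True
      then show ?thesis
        unfolding outer_swap[OF st] using uv1 True by (auto simp: outer_def)
    next
      case False
      then show ?thesis
        unfolding outer_swap[OF st] using uv True by simp
    qed
    then show ?thesis using True by (simp add: M_def cnj_iff)
  next
    case False
    then show ?thesis using st by (auto simp: M_def cnj_iff less_2_cases_iff)
  qed
  then show "X_mat n H F u v \<in> PD n"
    unfolding PD_iff[OF assms] X by blast
  have fin: "finite H" "finite F" "finite C"
    using R finite_negaroots[OF assms] by (metis finite_Un)+
  \<comment> \<open>As \<open>F\<close> and \<open>C\<close> have equal size, the rank
    \<open>card H + 2 * card F\<close> is the number of roots.\<close>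
  have "card H + card F + card C = n"
    using card_negaroots[OF assms] fin disj unfolding R[symmetric]
    by (simp add: card_Un_disjoint Int_Un_distrib2)
  moreover have "vec_space.rank (2 * n) (spectral n M) = card H + 2 * card F"
    unfolding M_def using assms R disj unit by (rule rank_spectral_partition)
  ultimately have "vec_space.rank (2 * n) (spectral n M) = n" using card by simp
  moreover have "cnj (M \<zeta> t s) = M \<zeta> s t" for \<zeta> s t
    by (auto simp: M_def outer_def)
  moreover have "(\<Sum>r<2. M \<zeta> s r * M \<zeta> r t) = M \<zeta> s t" if "s < 2" "t < 2" for \<zeta> s t
    using that outer_idempotent[OF unit[of \<zeta>]]
    by (auto simp: M_def less_2_cases_iff numeral_2_eq_2)
  ultimately show "self_adjoint_idempotent_of_rank (2 * n) n (X_mat n H F u v)"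
    unfolding X self_adjoint_idempotent_spectral_iff[OF assms] by blast
next
  fix X assume "X \<in> PD n" and sai: "self_adjoint_idempotent_of_rank (2 * n) n X"
  then obtain M where X: "X = spectral n M" and
    sym: "\<And>\<zeta> s t. \<zeta> \<in> negaroots n \<Longrightarrow> s < 2 \<Longrightarrow> t < 2 \<Longrightarrow> M (cnj \<zeta>) (1 - s) (1 - t) = M \<zeta> s t"
    unfolding PD_iff[OF assms] by blast
  have adj: "\<And>\<zeta> s t. \<zeta> \<in> negaroots n \<Longrightarrow> s < 2 \<Longrightarrow> t < 2 \<Longrightarrow> cnj (M \<zeta> t s) = M \<zeta> s t"
    and idem: "\<And>\<zeta> s t. \<zeta> \<in> negaroots n \<Longrightarrow> s < 2 \<Longrightarrow> t < 2 \<Longrightarrow> (\<Sum>r<2. M \<zeta> s r * M \<zeta> r t) = M \<zeta> s t"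
    and rank: "vec_space.rank (2 * n) (spectral n M) = n"
    using sai unfolding X self_adjoint_idempotent_spectral_iff[OF assms] by blast+
  \<comment> \<open>Roots are sorted by the trace of \<open>M \<zeta>\<close>, that is, by its
    rank.\<close>
  define T where "T k = {\<zeta> \<in> negaroots n. M \<zeta> 0 0 + M \<zeta> 1 1 = of_nat k}" for k :: nat
  define H F C where "H = T 1" and "F = T 2" and "C = T 0"
  have cases: "(\<zeta> \<in> C \<and> (\<forall>s<2. \<forall>t<2. M \<zeta> s t = 0)) \<or>
      (\<zeta> \<in> F \<and> (\<forall>s<2. \<forall>t<2. M \<zeta> s t = (if s = t then 1 else 0))) \<or>
      (\<zeta> \<in> H \<and> (\<exists>u v. (cmod v)\<^sup>2 + (cmod u)\<^sup>2 = 1 \<and> (\<forall>s<2. \<forall>t<2. M \<zeta> s t = outer u v s t)))"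
    if \<zeta>: "\<zeta> \<in> negaroots n" for \<zeta>
    using adj[OF \<zeta>] idem[OF \<zeta>]
  proof (rule projection_2x2_cases)
  qed (use \<zeta> in \<open>auto simp: H_def F_def C_def T_def\<close>)
  have disjT: "T k \<inter> T l = {}" if "k \<noteq> l" for k l
    using that by (auto simp: T_def)
  have disj: "H \<inter> F = {}" "H \<inter> C = {}" "F \<inter> C = {}"
    unfolding H_def F_def C_def by (simp_all add: disjT)
  have R: "H \<union> F \<union> C = negaroots n"
    using cases by (auto simp: H_def F_def C_def T_def)
  \<comment> \<open>The swap exchanges the diagonal entries and so preserves the trace.\<close>
  have cnjT: "cnj \<zeta> \<in> T k" if "\<zeta> \<in> T k" for \<zeta> k
    using that sym[of \<zeta> 0 0] sym[of \<zeta> 1 1] by (simp add: T_def add.commute)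
  \<comment> \<open>These vectors are chosen separately for each root, so those at conjugate roots
    need not be related.\<close>
  have "\<exists>w x. \<forall>\<zeta>\<in>H. (cmod (x \<zeta>))\<^sup>2 + (cmod (w \<zeta>))\<^sup>2 = 1 \<and>
      (\<forall>s<2. \<forall>t<2. M \<zeta> s t = outer (w \<zeta>) (x \<zeta>) s t)"
    using cases disj R by (metis (no_types, lifting) UnI1 disjoint_iff)
  then obtain w x where wx: "\<And>\<zeta>. \<zeta> \<in> H \<Longrightarrow> (cmod (x \<zeta>))\<^sup>2 + (cmod (w \<zeta>))\<^sup>2 = 1"
      "\<And>\<zeta> s t. \<zeta> \<in> H \<Longrightarrow> s < 2 \<Longrightarrow> t < 2 \<Longrightarrow> M \<zeta> s t = outer (w \<zeta>) (x \<zeta>) s t"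
    by blast
  \<comment> \<open>The choice is kept in the upper half plane and carried to the lower one by the
    swap. At \<open>-1\<close>, \<open>u = 1 / sqrt 2\<close> and
    \<open>v * cnj u = M (-1) 1 0\<close> force the value of \<open>v\<close>.\<close>
  define u v where "u \<zeta> = (if \<zeta> = -1 then of_real (1 / sqrt 2) else if Im \<zeta> > 0 then w \<zeta> else x (cnj \<zeta>))"
    and "v \<zeta> = (if \<zeta> = -1 then of_real (sqrt 2) * M (-1) 1 0 else if Im \<zeta> > 0 then x \<zeta> else w (cnj \<zeta>))" for \<zeta>
  have HR: "\<zeta> \<in> negaroots n" "cnj \<zeta> \<in> H" if "\<zeta> \<in> H" for \<zeta>
    using that cnjT[of \<zeta> 1] by (auto simp: H_def T_def)
  \<comment> \<open>At the fixed root \<open>-1\<close> the block is invariant under the swap: trace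
    \<open>1\<close> gives the diagonal, and idempotence gives the off-diagonal entry up to
    sign.\<close>
  have M1: "M (-1) 0 0 = 1 / 2" "M (-1) 1 1 = 1 / 2" "M (-1) 0 1 = M (-1) 1 0"
    "M (-1) 1 0 = 1 / 2 \<or> M (-1) 1 0 = - 1 / 2" if "-1 \<in> H"
  proof -
    have R1: "-1 \<in> negaroots n" using HR that by blast
    have eq: "M (-1) 0 0 = M (-1) 1 1" "M (-1) 0 1 = M (-1) 1 0"
      using sym[OF R1, of 1 1] sym[OF R1, of 1 0] by simp_all
    moreover have "M (-1) 0 0 + M (-1) 1 1 = 1" using that by (simp add: H_def T_def)
    ultimately show diag: "M (-1) 0 0 = 1 / 2" "M (-1) 1 1 = 1 / 2"
      by (simp_all add: field_simps)
    show "M (-1) 0 1 = M (-1) 1 0" by (rule eq)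
    have "M (-1) 1 0 * M (-1) 1 0 = (1 / 2) * (1 / 2)"
      using idem[OF R1, of 0 0] eq(2) by (simp add: numeral_2_eq_2 diag(1) field_simps)
    then have "M (-1) 1 0 = 1 / 2 \<or> M (-1) 1 0 = - (1 / 2)"
      by (simp only: square_eq_iff)
    then show "M (-1) 1 0 = 1 / 2 \<or> M (-1) 1 0 = - 1 / 2" by simp
  qed
  have sqrt2: "complex_of_real (sqrt 2) * complex_of_real (sqrt 2) = 2"
    by (simp flip: of_real_mult)
  have half: "of_real (sqrt 2) * (1 / 2) = u (-1)"
    using sqrt2 by (simp add: u_def field_simps)
  have vm: "v (-1) = of_real (sqrt 2) * M (-1) 1 0"
    by (simp add: v_def)
  have u1: "u (-1) * cnj (u (-1)) = 1 / 2"
    using sqrt2 by (simp add: u_def)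
  have v1: "v (-1) = u (-1) \<and> M (-1) 1 0 = u (-1) * cnj (u (-1)) \<or>
      v (-1) = - u (-1) \<and> M (-1) 1 0 = - (u (-1) * cnj (u (-1)))"
    if "-1 \<in> H"
    using M1(4)[OF that]
  proof
    assume m: "M (-1) 1 0 = 1 / 2"
    have "v (-1) = u (-1)" unfolding vm m by (rule half)
    then show ?thesis unfolding u1 using m by simp
  next
    assume m: "M (-1) 1 0 = - 1 / 2"
    have "v (-1) = - u (-1)" unfolding vm m half[symmetric] by simp
    then show ?thesis unfolding u1 using m by simp
  qed
  \<comment> \<open>Apart from \<open>-1\<close>, the sign of the imaginary part thus selects one
    root of each conjugate pair.\<close>
  have Im0: "Im \<zeta> \<noteq> 0" if "\<zeta> \<in> H" "\<zeta> \<noteq> -1" for \<zeta>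
    using negaroots_real[OF assms] HR that by blast
  have outer: "M \<zeta> s t = outer (u \<zeta>) (v \<zeta>) s t" if H: "\<zeta> \<in> H" and st: "s < 2" "t < 2" for \<zeta> s t
  proof -
    consider "\<zeta> = -1" | "\<zeta> \<noteq> -1" "Im \<zeta> > 0" | "\<zeta> \<noteq> -1" "Im \<zeta> < 0"
      using Im0 H by force
    then show ?thesis
    proof cases
      case 1
      then show ?thesis
        using M1(1-3)[folded u1] v1 H st by (auto simp: outer_def less_2_cases_iff)
    next
      case 2
      then show ?thesis using wx(2)[OF H st] by (simp add: u_def v_def)
    next
      case 3
      \<comment> \<open>In the lower half plane the block is the swapped block of the conjugate
        root, whose vector has exchanged entries.\<close>
      have "M \<zeta> s t = M (cnj \<zeta>) (1 - s) (1 - t)"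
        using sym HR(1)[OF H] st by simp
      also have "\<dots> = outer (w (cnj \<zeta>)) (x (cnj \<zeta>)) (1 - s) (1 - t)"
        using HR(2)[OF H] st by (intro wx(2)) auto
      also have "\<dots> = outer (x (cnj \<zeta>)) (w (cnj \<zeta>)) s t"
        using st by (rule outer_swap)
      finally show ?thesis using 3 by (simp add: u_def v_def)
    qed
  qed
  have choice: "unit_vector_choice H u v"
    unfolding unit_vector_choice_def
  proof (intro conjI ballI impI)
    fix \<zeta> assume H: "\<zeta> \<in> H" "\<zeta> \<noteq> -1"
    then have ne: "cnj \<zeta> \<noteq> -1" by (metis complex_cnj_cnj complex_cnj_minus complex_cnj_one)
    show "v (cnj \<zeta>) = u \<zeta>" "u (cnj \<zeta>) = v \<zeta>"
      using Im0[OF H] H(2) ne by (auto simp: u_def v_def)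
    show "(cmod (v \<zeta>))\<^sup>2 + (cmod (u \<zeta>))\<^sup>2 = 1"
      using H(2) wx(1)[OF H(1)] wx(1)[OF HR(2)[OF H(1)]] by (simp add: u_def v_def add.commute)
  next
    assume H: "-1 \<in> H"
    show "u (-1) = of_real (1 / sqrt 2)" by (simp add: u_def)
    show "v (-1) = of_real (1 / sqrt 2) \<or> v (-1) = - of_real (1 / sqrt 2)"
      using v1[OF H] by (auto simp: u_def)
  qed
  have unit: "(cmod (v \<zeta>))\<^sup>2 + (cmod (u \<zeta>))\<^sup>2 = 1" if "\<zeta> \<in> H" for \<zeta>
    using choice that by (rule unit_vector_choice_norm)
  have X': "X = spectral n (\<lambda>\<zeta> s t. if \<zeta> \<in> H then outer (u \<zeta>) (v \<zeta>) s t
    else if \<zeta> \<in> F then if s = t then 1 else 0 else 0)"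
    unfolding X
  proof (rule spectral_cong)
    fix \<zeta> s t assume "\<zeta> \<in> negaroots n" "s < (2::nat)" "t < (2::nat)"
    then show "M \<zeta> s t = (if \<zeta> \<in> H then outer (u \<zeta>) (v \<zeta>) s t
        else if \<zeta> \<in> F then if s = t then 1 else 0 else 0)"
      using cases[of \<zeta>] outer[of \<zeta> s t] disj by auto
  qed
  have fin: "finite H" "finite F" "finite C"
    using R finite_negaroots[OF assms] by (metis finite_Un)+
  have "card H + card F + card C = n"
    using card_negaroots[OF assms] fin disj unfolding R[symmetric]
    by (simp add: card_Un_disjoint Int_Un_distrib2)
  \<comment> \<open>The rank hypothesis, compared with the number of roots, yields
    \<open>card F = card C\<close>.\<close>
  moreover have "card H + 2 * card F = n"
    using rank_spectral_partition[where u = u and v = v, OF assms R disj unit] rank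
    unfolding X[symmetric] X'[symmetric] by simp
  ultimately have "card F = card C" by simp
  then have "root_partition n H F C"
    unfolding root_partition_def mu_diff_eq_negaroots
    using R disj cnjT by (auto simp: H_def F_def C_def)
  moreover have "X = X_mat n H F u v"
    unfolding X' using assms R disj(1) by (intro X_mat_eq_spectral[symmetric]) auto
  ultimately show "\<exists>H F C u v. root_partition n H F C \<and> unit_vector_choice H u v \<and> X = X_mat n H F u v"
    using choice by blast
qed

end
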